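(* Let $G$ be a triangle-free $(n,d,\lambda)$-graph with $7\le d\le n-1$, and let $k\ge2$. Then $G^{(k)}=G\boxtimes K_k$ is a $(kn,\,kd+k-1,\,k\lambda+k-1)$-graph which does not contain a topological minor of $K_t$ for $t=kd+2$.
   Context: A $d$-regular graph on $n$ vertices is an $(n,d,\lambda)$-graph if all eigenvalues of its adjacency matrix, except the largest one, are at most $\lambda$ in absolute value. The strong product $G_1\boxtimes G_2$ is the graph on $V(G_1)\times V(G_2)$ in which $(u_1,u_2)$ is adjacent to $(v_1,v_2)$ iff either $u_1=v_1$ and $u_2v_2\in E(G_2)$, or $u_2=v_2$ and $u_1v_1\in E(G_1)$, or $u_1v_1\in E(G_1)$ and $u_2v_2\in E(G_2)$. A graph $H$ is a topological minor of $G$ if some subdivision of $H$ is a subgraph of $G$. *)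

theory Defs
  imports
    "Graph_Theory.Graph_Theory"
    "Jordan_Normal_Form.Char_Poly"
begin

text \<open>
  Finite simple graphs are values \<open>G :: 'a pair_pre_digraph\<close> with \<^term>\<open>pair_graph G\<close>: an edge
  \<open>uv\<close> is stored as the two arcs \<open>(u, v)\<close> and \<open>(v, u)\<close>.
\<close>

definition regular_graph :: "'a pair_pre_digraph \<Rightarrow> nat \<Rightarrow> bool" where
  "regular_graph G d \<longleftrightarrow> pair_graph G \<and> (\<forall>v \<in> pverts G. out_degree (with_proj G) v = d)"

definition triangle_free :: "'a pair_pre_digraph \<Rightarrow> bool" where
  "triangle_free G \<longleftrightarrow>
     \<not> (\<exists>u v w. (u, v) \<in> parcs G \<and> (v, w) \<in> parcs G \<and> (u, w) \<in> parcs G)"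

definition adjacency_mat :: "'a list \<Rightarrow> 'a pair_pre_digraph \<Rightarrow> real mat" where
  "adjacency_mat vs G =
     mat (length vs) (length vs) (\<lambda>(i, j). if (vs ! i, vs ! j) \<in> parcs G then 1 else 0)"

text \<open>
  The eigenvalues of the adjacency matrix with their multiplicities. The matrix is real symmetric,
  so all roots of its characteristic polynomial are real and this multiset has as many elements as
  the graph has vertices. The chosen listing of the vertices is irrelevant, see
  \<open>graph_eigenvalues_eq\<close> below.
\<close>

definition graph_eigenvalues :: "'a pair_pre_digraph \<Rightarrow> real multiset" where
  "graph_eigenvalues G =
     proots (char_poly (adjacency_mat (SOME vs. distinct vs \<and> set vs = pverts G) G))"

text \<open>
  Only one copy of the largest eigenvalue is exempt from the bound: if the largest eigenvalue is
  not simple, its remaining copies must be bounded by \<open>lam\<close> as well.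
\<close>

definition ndl_graph :: "nat \<Rightarrow> nat \<Rightarrow> real \<Rightarrow> 'a pair_pre_digraph \<Rightarrow> bool" where
  "ndl_graph n d lam G \<longleftrightarrow>
     regular_graph G d \<and> card (pverts G) = n \<and>
     (\<forall>\<mu> \<in># graph_eigenvalues G - {# Max_mset (graph_eigenvalues G) #}. \<bar>\<mu>\<bar> \<le> lam)"

definition strong_product ::
    "'a pair_pre_digraph \<Rightarrow> 'b pair_pre_digraph \<Rightarrow> ('a \<times> 'b) pair_pre_digraph"
    (infixl \<open>\<boxtimes>\<close> 70) where
  "G1 \<boxtimes> G2 = \<lparr>
     pverts = pverts G1 \<times> pverts G2,
     parcs = {((u1, u2), (v1, v2)) | u1 u2 v1 v2.
       (u1 = v1 \<and> u1 \<in> pverts G1 \<and> (u2, v2) \<in> parcs G2) \<or>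
       (u2 = v2 \<and> u2 \<in> pverts G2 \<and> (u1, v1) \<in> parcs G1) \<or>
       ((u1, v1) \<in> parcs G1 \<and> (u2, v2) \<in> parcs G2)} \<rparr>"

definition complete_pair_graph :: "nat \<Rightarrow> nat pair_pre_digraph" where
  "complete_pair_graph m =
     \<lparr> pverts = {..<m}, parcs = {(i, j). i < m \<and> j < m \<and> i \<noteq> j} \<rparr>"

text \<open>
  \<^term>\<open>subdivision_pair\<close> relates graphs over one vertex type, so \<open>H\<close> is first replaced by an
  isomorphic copy \<open>H'\<close> among the vertices of \<open>G\<close>. Nothing is lost: a subgraph of \<open>G\<close>
  that is a subdivision of \<open>H\<close> contains the branch vertices, hence such a copy of \<open>H\<close>'s vertices.
\<close>

definition topological_minor :: "'b pair_pre_digraph \<Rightarrow> 'a pair_pre_digraph \<Rightarrow> bool" where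
  "topological_minor H G \<longleftrightarrow>
     (\<exists>(H' :: 'a pair_pre_digraph) (S :: 'a pair_pre_digraph).
        digraph_iso (with_proj H) (with_proj H') \<and>
        subdivision_pair H' S \<and> subgraph (with_proj S) (with_proj G))"

lemma complete_digraph_complete_pair_graph:
  "complete_digraph m (with_proj (complete_pair_graph m))"
  unfolding complete_digraph_pair_def by (auto simp: complete_pair_graph_def)

lemma pair_graph_strong_product:
  assumes "pair_graph G1" "pair_graph G2"
  shows "pair_graph (G1 \<boxtimes> G2)"
proof -
  interpret G1: pair_graph G1 by fact
  interpret G2: pair_graph G2 by fact
  have fin: "finite (pverts (G1 \<boxtimes> G2))"
    by (simp add: strong_product_def G1.pair_finite_verts G2.pair_finite_verts)
  have sub: "parcs (G1 \<boxtimes> G2) \<subseteq> pverts (G1 \<boxtimes> G2) \<times> pverts (G1 \<boxtimes> G2)"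
    by (auto simp: strong_product_def dest: G1.wellformed' G2.wellformed')
  have fina: "finite (parcs (G1 \<boxtimes> G2))"
    using finite_subset[OF sub] fin by blast
  show ?thesis
  proof
    show "symmetric (with_proj (G1 \<boxtimes> G2))"
      unfolding symmetric_def with_proj_simps
      by (rule symI)
         (auto simp: strong_product_def dest: G1.arcs_symmetric G2.arcs_symmetric)
    show "fst e \<noteq> snd e" if "e \<in> parcs (G1 \<boxtimes> G2)" for e
      using that
      by (auto simp: strong_product_def dest: G1.no_loops' G2.no_loops')
  qed (use fin fina sub in auto)
qed

lemma char_poly_adjacency_mat_cong:
  assumes vs: "distinct vs" and ws: "distinct ws" and eq: "set vs = set ws"
  shows "char_poly (adjacency_mat vs G) = char_poly (adjacency_mat ws G)"
proof -
  define n where "n = length vs"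
  have lw: "length ws = n"
    using vs ws eq by (metis distinct_card n_def)
  have "\<exists>j < n. vs ! j = ws ! i" if "i < n" for i
    using that lw eq by (metis in_set_conv_nth n_def nth_mem)
  then obtain p where p: "\<And>i. i < n \<Longrightarrow> p i < n \<and> vs ! p i = ws ! i"
    by metis
  have inj: "inj_on p {0..<n}"
    by (rule inj_onI) (metis atLeastLessThan_iff lw nth_eq_iff_index_eq p ws)
  have surj: "p ` {0..<n} = {0..<n}"
    by (rule endo_inj_surj) (use inj p in auto)
  define P :: "real mat" where "P = mat n n (\<lambda>(i, j). if j = p i then 1 else 0)"
  define Q :: "real mat" where "Q = mat n n (\<lambda>(i, j). if i = p j then 1 else 0)"
  define A where "A = adjacency_mat vs G"
  define B where "B = adjacency_mat ws G"
  have carr: "P \<in> carrier_mat n n" "Q \<in> carrier_mat n n"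
      "A \<in> carrier_mat n n" "B \<in> carrier_mat n n"
    by (auto simp: P_def Q_def A_def B_def adjacency_mat_def n_def lw[unfolded n_def])
  have pinj: "p i = p j \<longleftrightarrow> i = j" if "i < n" "j < n" for i j
    using inj that by (auto simp: inj_on_def)
  have PQ: "P * Q = 1\<^sub>m n"
  proof (rule eq_matI)
    fix i j assume "i < dim_row (1\<^sub>m n :: real mat)" "j < dim_col (1\<^sub>m n :: real mat)"
    then have ij: "i < n" "j < n" by auto
    have "(P * Q) $$ (i, j) =
        (\<Sum>k = 0..<n. (if k = p i then 1 else 0) * (if k = p j then 1 else 0))"
      using ij by (simp add: P_def Q_def scalar_prod_def)
    also have "\<dots> = (\<Sum>k = 0..<n. if k = p i then (if p i = p j then 1 else 0) else 0)"
      by (rule sum.cong) auto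
    also have "\<dots> = (if p i = p j then 1 else 0)"
      using p ij by (simp add: sum.delta)
    finally show "(P * Q) $$ (i, j) = 1\<^sub>m n $$ (i, j)"
      using ij pinj by simp
  qed (use carr in auto)
  have QP: "Q * P = 1\<^sub>m n"
    using mat_mult_left_right_inverse[OF carr(1,2) PQ] .
  have PA: "(P * A) $$ (i, j) = A $$ (p i, j)" if "i < n" "j < n" for i j
  proof -
    have "(P * A) $$ (i, j) = (\<Sum>k = 0..<n. (if k = p i then 1 else 0) * A $$ (k, j))"
      using that carr by (simp add: P_def scalar_prod_def)
    also have "\<dots> = (\<Sum>k = 0..<n. if k = p i then A $$ (p i, j) else 0)"
      by (rule sum.cong) auto
    also have "\<dots> = A $$ (p i, j)"
      using p that by (simp add: sum.delta)
    finally show ?thesis .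
  qed
  have "B = P * A * Q"
  proof (rule eq_matI)
    fix i j assume "i < dim_row (P * A * Q)" "j < dim_col (P * A * Q)"
    then have ij: "i < n" "j < n" using carr by auto
    have "(P * A * Q) $$ (i, j) =
        (\<Sum>k = 0..<n. (P * A) $$ (i, k) * (if k = p j then 1 else 0))"
      using ij carr by (simp add: Q_def scalar_prod_def)
    also have "\<dots> = (\<Sum>k = 0..<n. if k = p j then A $$ (p i, p j) else 0)"
      by (rule sum.cong) (use PA ij p in auto)
    also have "\<dots> = A $$ (p i, p j)"
      using p ij by (simp add: sum.delta)
    also have "\<dots> = B $$ (i, j)"
      using p ij lw by (simp add: A_def B_def adjacency_mat_def n_def[symmetric])
    finally show "B $$ (i, j) = (P * A * Q) $$ (i, j)" by simp
  qed (use carr in auto)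
  then have "similar_mat_wit B A P Q"
    using carr PQ QP by (auto simp: similar_mat_wit_def Let_def)
  then have "similar_mat B A"
    unfolding similar_mat_def by blast
  then show ?thesis
    using char_poly_similar unfolding A_def B_def by metis
qed

lemma graph_eigenvalues_eq:
  assumes "distinct vs" "set vs = pverts G"
  shows "graph_eigenvalues G = proots (char_poly (adjacency_mat vs G))"
proof -
  have "distinct (SOME vs. distinct vs \<and> set vs = pverts G) \<and>
      set (SOME vs. distinct vs \<and> set vs = pverts G) = pverts G"
    by (rule someI[of _ vs]) (use assms in auto)
  then show ?thesis
    unfolding graph_eigenvalues_def
    using assms by (metis char_poly_adjacency_mat_cong)
qed

end

theory Submission
  imports Defs
begin

text \<open>
  Spectrum: over a suitable listing of the vertices, the adjacency matrix of \<open>G \<boxtimes> K\<^sub>k\<close> is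
  \<open>J \<otimes> (A + 1) - 1\<close> with \<open>J\<close> the all-ones \<open>k \<times> k\<close> matrix, so its eigenvalues are
  \<open>k a + k - 1\<close> for the eigenvalues \<open>a\<close> of \<open>G\<close>, and \<open>- 1\<close> with multiplicity \<open>(k - 1) n\<close>.

  Topological minor: suppose the branch vertices of a subdivided \<open>K\<^sub>t\<close> with \<open>t = k d + 2\<close> include
  one over \<open>v\<close> and one over \<open>w\<close>, where \<open>w\<close> is neither \<open>v\<close> nor a neighbour of \<open>v\<close>. The \<open>k d\<close>
  vertices over the neighbours of \<open>v\<close> separate the two, but by a Menger-type count a separator
  needs \<open>t - 1\<close> vertices. Hence the vertices of \<open>G\<close> below the branch vertices are pairwise
  adjacent; by triangle-freeness there are at most two of them, and \<open>t \<le> 2 k\<close>.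
\<close>

section \<open>Subdivided cliques\<close>

text \<open>
  The last clause says that \<open>I {u, v} \<union> {u, v}\<close> carries a path from \<open>u\<close> to \<open>v\<close>, expressed by
  cuts: this form survives the subdivision of an arc without any handling of paths.
\<close>

definition interior_system ::
    "'a pair_pre_digraph \<Rightarrow> 'a pair_pre_digraph \<Rightarrow> ('a set \<Rightarrow> 'a set) \<Rightarrow> bool" where
  "interior_system H S I \<longleftrightarrow>
     (\<forall>(u, v) \<in> parcs H. I {u, v} \<subseteq> pverts S - pverts H) \<and>
     (\<forall>(u, v) \<in> parcs H. \<forall>(x, y) \<in> parcs H. {u, v} \<noteq> {x, y} \<longrightarrow> I {u, v} \<inter> I {x, y} = {}) \<and>
     (\<forall>(u, v) \<in> parcs H. \<forall>X. u \<in> X \<longrightarrow> v \<notin> X \<longrightarrow>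
        (\<exists>a b. (a, b) \<in> parcs S \<and> a \<in> X \<and> b \<notin> X \<and> {a, b} \<subseteq> I {u, v} \<union> {u, v}))"

lemma interior_systemI:
  assumes "\<And>u v. (u, v) \<in> parcs H \<Longrightarrow> I {u, v} \<subseteq> pverts S - pverts H"
    and "\<And>u v x y. \<lbrakk>(u, v) \<in> parcs H; (x, y) \<in> parcs H; {u, v} \<noteq> {x, y}\<rbrakk> \<Longrightarrow>
      I {u, v} \<inter> I {x, y} = {}"
    and "\<And>u v X. \<lbrakk>(u, v) \<in> parcs H; u \<in> X; v \<notin> X\<rbrakk> \<Longrightarrow>
      \<exists>a b. (a, b) \<in> parcs S \<and> a \<in> X \<and> b \<notin> X \<and> {a, b} \<subseteq> I {u, v} \<union> {u, v}"
  shows "interior_system H S I"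
  unfolding interior_system_def case_prod_unfold using assms
  by (intro conjI ballI allI impI) simp_all

lemma interior_systemD:
  assumes "interior_system H S I" "(u, v) \<in> parcs H"
  shows "I {u, v} \<subseteq> pverts S - pverts H"
    and "\<lbrakk>(x, y) \<in> parcs H; {u, v} \<noteq> {x, y}\<rbrakk> \<Longrightarrow> I {u, v} \<inter> I {x, y} = {}"
    and "\<lbrakk>u \<in> X; v \<notin> X\<rbrakk> \<Longrightarrow>
      \<exists>a b. (a, b) \<in> parcs S \<and> a \<in> X \<and> b \<notin> X \<and> {a, b} \<subseteq> I {u, v} \<union> {u, v}"
proof -
  note sys = assms(1)[unfolded interior_system_def]
  show "I {u, v} \<subseteq> pverts S - pverts H"
    using bspec[OF conjunct1[OF sys] assms(2)] by simp
  show "I {u, v} \<inter> I {x, y} = {}" if "(x, y) \<in> parcs H" "{u, v} \<noteq> {x, y}"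
    using bspec[OF conjunct1[OF conjunct2[OF sys]] assms(2)] that by blast
  show "\<exists>a b. (a, b) \<in> parcs S \<and> a \<in> X \<and> b \<notin> X \<and> {a, b} \<subseteq> I {u, v} \<union> {u, v}"
    if "u \<in> X" "v \<notin> X"
    using bspec[OF conjunct2[OF conjunct2[OF sys]] assms(2)] that by simp
qed

text \<open>Induction on the number of divided edges. At the start every interior is empty and each
  edge is its own path. Dividing an arc hands the new vertex to the one edge of \<open>H\<close>
  whose path region \<open>I e \<union> e\<close> contains both ends of that arc, if there is such
  an edge.\<close>

lemma subdivision_pair_interior_system:
  assumes "subdivision_pair H S"
  shows "\<exists>I. interior_system H S I"
  using assms
proof (induction rule: subdivision_pair_induct)
  case base
  show ?case
    unfolding interior_system_def by (rule exI[of _ "\<lambda>_. {}"]) auto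
next
  case (divide e w K)
  interpret H: pair_bidirected_digraph H
    using divide.hyps(3) by (induction rule: subdivision_pair_induct) auto
  interpret K: pair_bidirected_digraph K
    using divide.hyps(3) by (rule bidirected_digraphI_subdivision)
  obtain p q where e: "e = (p, q)" by (cases e)
  have pq: "(p, q) \<in> parcs K" "(q, p) \<in> parcs K" "p \<noteq> q" "p \<in> pverts K" "q \<in> pverts K"
    using divide.hyps(1) e K.arcs_symmetric K.no_loops' K.wellformed' by blast+
  have HK: "pverts H \<subseteq> pverts K"
    using subdivision_verts_subset[OF divide.hyps(3)] by auto
  obtain I where "interior_system H K I" using divide.IH ..
  note I = interior_systemD(1)[OF this] and disj = interior_systemD(2)[OF this]
    and cut = interior_systemD(3)[OF this]
  define J where "J e = (if {p, q} \<subseteq> I e \<union> e then insert w (I e) else I e)" for e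
  \<comment> \<open>Interiors are disjoint and avoid \<open>pverts H\<close>, so a vertex in the
    regions of two distinct edges is an end of both. Two distinct edges share at most one end, but
    \<open>p \<noteq> q\<close>. Hence \<open>w\<close> enters at most one interior and the
    interiors stay disjoint.\<close>
  have uniq: "{u, v} = {x, y}"
    if "(u, v) \<in> parcs H" "(x, y) \<in> parcs H" "{p, q} \<subseteq> I {u, v} \<union> {u, v}"
      "{p, q} \<subseteq> I {x, y} \<union> {x, y}" for u v x y
  proof (rule ccontr)
    assume ne: "{u, v} \<noteq> {x, y}"
    have V: "{u, v} \<subseteq> pverts H" "{x, y} \<subseteq> pverts H"
      using H.wellformed'[OF that(1)] H.wellformed'[OF that(2)] by auto
    note D = disj[OF that(1,2) ne] I[OF that(1)] I[OF that(2)]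
    have "p \<in> {u, v} \<inter> {x, y}" "q \<in> {u, v} \<inter> {x, y}"
      using D V that(3,4) by auto
    then show False using ne pq(3) by auto
  qed
  have w: "w \<notin> pverts K" using divide.hyps by simp
  have wH: "w \<notin> pverts H" using HK w by auto
  have "interior_system H (subdivide K e w) J"
  proof (rule interior_systemI)
    fix u v assume "(u, v) \<in> parcs H"
    then show "J {u, v} \<subseteq> pverts (subdivide K e w) - pverts H"
      using I[of u v] wH by (auto simp: J_def)
  next
    fix u v x y assume a: "(u, v) \<in> parcs H" "(x, y) \<in> parcs H" "{u, v} \<noteq> {x, y}"
    have "w \<notin> I {u, v}" "w \<notin> I {x, y}" using I a w by blast+
    then show "J {u, v} \<inter> J {x, y} = {}"
      using disj[OF a] uniq[OF a(1,2)] a(3) by (auto simp: J_def)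
  next
    fix u v X assume a: "(u, v) \<in> parcs H" "u \<in> X" "v \<notin> X"
    obtain a b where ab: "(a, b) \<in> parcs K" "a \<in> X" "b \<notin> X" "{a, b} \<subseteq> I {u, v} \<union> {u, v}"
      using cut[OF a] by blast
    show "\<exists>a b. (a, b) \<in> parcs (subdivide K e w) \<and> a \<in> X \<and> b \<notin> X \<and> {a, b} \<subseteq> J {u, v} \<union> {u, v}"
    proof (cases "{a, b} = {p, q}")
      case False
      then have "(a, b) \<in> parcs (subdivide K e w)" using ab(1) by (auto simp: e)
      moreover have "{a, b} \<subseteq> J {u, v} \<union> {u, v}" using ab(4) by (auto simp: J_def)
      ultimately show ?thesis using ab by blast
    next
      case True
      then have J: "J {u, v} = insert w (I {u, v})" using ab(4) by (auto simp: J_def)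
      have "(a, w) \<in> parcs (subdivide K e w)" "(w, b) \<in> parcs (subdivide K e w)"
        using True by (auto simp: e doubleton_eq_iff)
      \<comment> \<open>If the arc crossing the cut was divided, one of its halves crosses:
        \<open>(w, b)\<close> when \<open>w\<close> lies in \<open>X\<close>, and
        \<open>(a, w)\<close> otherwise.\<close>
      then show ?thesis using ab J by (cases "w \<in> X") blast+
    qed
  qed
  then show ?case by blast
qed

text \<open>
  Follow the path from \<open>b\<close> to each branch vertex outside \<open>F\<close>, and the path to \<open>c\<close> from each of
  the others: every branch vertex besides \<open>b\<close> receives an exit vertex in \<open>N\<close> of its own.
\<close>

lemma clique_subdivision_separator:
  assumes sub: "subdivision_pair H S"
    and clique: "\<And>x y. \<lbrakk>x \<in> pverts H; y \<in> pverts H; x \<noteq> y\<rbrakk> \<Longrightarrow> (x, y) \<in> parcs H"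
    and exit: "\<And>x y. \<lbrakk>(x, y) \<in> parcs S; x \<in> F; y \<notin> F\<rbrakk> \<Longrightarrow> y \<in> N"
    and "finite N"
    and b: "b \<in> pverts H" "b \<in> F"
    and c: "c \<in> pverts H" "c \<notin> F" "c \<notin> N"
  shows "card (pverts H) \<le> card N + 1"
proof -
  obtain I where "interior_system H S I" using subdivision_pair_interior_system[OF sub] by blast
  note I = interior_systemD(1)[OF this] and disj = interior_systemD(2)[OF this]
    and cut = interior_systemD(3)[OF this]
  define B where "B = pverts H - {b}"
  define l where "l x = (if x \<in> F then x else b)" for x
  define r where "r x = (if x \<in> F then c else x)" for x
  have lr: "(l x, r x) \<in> parcs H" "l x \<in> F" "r x \<notin> F" "r x \<in> N \<longrightarrow> x \<in> N"
    if "x \<in> B" for x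
    using that b c by (auto simp: B_def l_def r_def intro!: clique)
  \<comment> \<open>The path of a branch vertex \<open>x\<close> in \<open>N - F\<close> may leave
    \<open>F\<close> only at \<open>x\<close> itself, so \<open>x\<close> serves as its own exit.
    For every other \<open>x\<close> the end \<open>r x\<close> is not in \<open>N\<close>, which
    forces the exit into the interior of the path.\<close>
  have "\<exists>z. z \<in> N \<and> (if x \<in> N - F then z = x else z \<in> I {l x, r x})" if x: "x \<in> B" for x
  proof (cases "x \<in> N - F")
    case False
    obtain y z where yz: "(y, z) \<in> parcs S" "y \<in> F" "z \<notin> F" "{y, z} \<subseteq> I {l x, r x} \<union> {l x, r x}"
      using cut[OF lr(1-3)] x by blast
    then have "z \<in> N" using exit by blast
    moreover have "r x \<notin> N" using False c(3) by (auto simp: r_def)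
    ultimately have "z \<in> I {l x, r x}" using yz lr(2)[OF x] by auto
    then show ?thesis using \<open>z \<in> N\<close> False by auto
  qed auto
  then obtain f where f: "\<And>x. x \<in> B \<Longrightarrow> f x \<in> N"
      "\<And>x. x \<in> B \<Longrightarrow> x \<in> N - F \<Longrightarrow> f x = x"
      "\<And>x. x \<in> B \<Longrightarrow> x \<notin> N - F \<Longrightarrow> f x \<in> I {l x, r x}"
    by metis
  have new: "f x \<notin> pverts H" if "x \<in> B" "x \<notin> N - F" for x
    using f(3)[OF that] I lr(1)[OF that(1)] by blast
  have "inj_on f B"
  proof (rule inj_onI)
    fix x y assume xy: "x \<in> B" "y \<in> B" "f x = f y"
    have BH: "x \<in> pverts H" "y \<in> pverts H" using xy by (auto simp: B_def)
    \<comment> \<open>Exits of the first kind are branch vertices and those of the second kind are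
      not, so a mixed collision is impossible.\<close>
    consider "x \<in> N - F" "y \<in> N - F" | "x \<notin> N - F" "y \<notin> N - F"
      using xy f(2) new BH by metis
    then show "x = y"
    proof cases
      case 1
      then show ?thesis using xy f(2) by metis
    next
      case 2
      have "{l x, r x} = {l y, r y}"
      proof (rule ccontr)
        assume "{l x, r x} \<noteq> {l y, r y}"
        then have "I {l x, r x} \<inter> I {l y, r y} = {}" using disj lr(1) xy by simp
        then show False using f(3)[OF xy(1) 2(1)] f(3)[OF xy(2) 2(2)] xy(3) by auto
      qed
      \<comment> \<open>The \<open>l\<close> ends lie in \<open>F\<close> and the \<open>r\<close>
        ends outside, so equal unordered pairs agree end by end. Such a pair determines
        \<open>x\<close>: removing \<open>b\<close> from \<open>B\<close> leaves \<open>c\<close> as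
        the only source of the pair \<open>b\<close>, \<open>c\<close>.\<close>
      then have "l x = l y" "r x = r y" using lr[OF xy(1)] lr[OF xy(2)] by (auto simp: doubleton_eq_iff)
      then show ?thesis using xy(1,2) b by (auto simp: l_def r_def B_def split: if_splits)
    qed
  qed
  then have "card B \<le> card N"
    using f(1) \<open>finite N\<close> by (intro card_inj_on_le[of f]) auto
  then show ?thesis by (simp add: B_def card_Diff_singleton[OF b(1)])
qed

lemma digraph_iso_complete_pair_graph:
  assumes "digraph_iso (with_proj (complete_pair_graph t)) (with_proj H)"
  shows "card (pverts H) = t"
    and "\<lbrakk>x \<in> pverts H; y \<in> pverts H; x \<noteq> y\<rbrakk> \<Longrightarrow> (x, y) \<in> parcs H"
proof -
  obtain f where f: "pre_digraph.digraph_isomorphism (with_proj (complete_pair_graph t)) f"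
    and H: "with_proj H = app_iso f (with_proj (complete_pair_graph t))"
    using assms unfolding digraph_iso_def by auto
  have V: "pverts H = iso_verts f ` {..<t}"
    using arg_cong[OF H, of verts] by (simp add: complete_pair_graph_def)
  have A: "parcs H = iso_arcs f ` {(i, j). i < t \<and> j < t \<and> i \<noteq> j}"
    using arg_cong[OF H, of arcs] by (simp add: complete_pair_graph_def)
  \<comment> \<open>An isomorphism carries separate maps for vertices, arcs, tails and heads. On
    pair graphs tail and head must be the projections, which ties the arc map to the vertex
    map.\<close>
  have TH: "iso_tail f = fst" "iso_head f = snd"
    using arg_cong[OF H, of tail] arg_cong[OF H, of head] by simp_all
  have inj: "inj_on (iso_verts f) {..<t}"
    and ends: "\<And>i j. \<lbrakk>i < t; j < t; i \<noteq> j\<rbrakk> \<Longrightarrow> iso_arcs f (i, j) = (iso_verts f i, iso_verts f j)"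
    using f TH unfolding pre_digraph.digraph_isomorphism_def
    by (auto simp: complete_pair_graph_def prod_eq_iff)
  show "card (pverts H) = t" unfolding V using card_image[OF inj] by simp
  show "(x, y) \<in> parcs H" if xy: "x \<in> pverts H" "y \<in> pverts H" "x \<noteq> y"
  proof -
    obtain i j where "i < t" "j < t" "x = iso_verts f i" "y = iso_verts f j"
      using xy V by auto
    moreover from this have "i \<noteq> j" using xy(3) by auto
    ultimately show ?thesis
      unfolding A using ends[of i j] by (intro image_eqI[of _ _ "(i, j)"]) auto
  qed
qed

section \<open>Adjacency and degrees in the strong product with a complete graph\<close>

lemma parcs_strong_product_complete:
  "((u, i), (v, j)) \<in> parcs (G \<boxtimes> complete_pair_graph k) \<longleftrightarrow>
    i < k \<and> j < k \<and> ((u, v) \<in> parcs G \<or> u = v \<and> u \<in> pverts G \<and> i \<noteq> j)"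
  by (auto simp: strong_product_def complete_pair_graph_def)

lemma pair_graph_complete: "pair_graph (complete_pair_graph k)"
proof -
  have "parcs (complete_pair_graph k) \<subseteq> {..<k} \<times> {..<k}"
    by (auto simp: complete_pair_graph_def)
  then have "finite (parcs (complete_pair_graph k))" by (rule finite_subset) simp
  then show ?thesis
    by unfold_locales (auto simp: complete_pair_graph_def symmetric_def intro: symI)
qed

lemma out_degree_eq_card: "out_degree (with_proj G) v = card {w. (v, w) \<in> parcs G}"
proof -
  have "out_arcs (with_proj G) v = Pair v ` {w. (v, w) \<in> parcs G}"
    by (auto simp: out_arcs_def)
  then show ?thesis
    by (simp add: out_degree_def card_image inj_on_def)
qed

lemma regular_graph_strong_product_complete:
  assumes "regular_graph G d" "1 \<le> k"
  shows "regular_graph (G \<boxtimes> complete_pair_graph k) (k * d + k - 1)"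
proof -
  have G: "pair_graph G" using assms by (simp add: regular_graph_def)
  interpret G: pair_graph G by fact
  have "card {w. (v, w) \<in> parcs (G \<boxtimes> complete_pair_graph k)} = k * d + k - 1"
    if v: "v \<in> pverts (G \<boxtimes> complete_pair_graph k)" for v
  proof -
    obtain u i where ui: "v = (u, i)" "u \<in> pverts G" "i < k"
      using v by (auto simp: strong_product_def complete_pair_graph_def)
    have eq: "{w. (v, w) \<in> parcs (G \<boxtimes> complete_pair_graph k)} =
        {x. (u, x) \<in> parcs G} \<times> {..<k} \<union> {u} \<times> ({..<k} - {i})"
      using ui by (auto simp: parcs_strong_product_complete)
    have "card {x. (u, x) \<in> parcs G} = d"
      using assms ui by (simp add: regular_graph_def out_degree_eq_card)
    moreover have "finite {x. (u, x) \<in> parcs G}"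
      by (rule finite_subset[OF _ G.pair_finite_verts]) (use G.wellformed' in auto)
    moreover have "(u, u) \<notin> parcs G" using G.no_loops' by blast
    ultimately have "card ({x. (u, x) \<in> parcs G} \<times> {..<k} \<union> {u} \<times> ({..<k} - {i})) =
        d * k + (k - 1)"
      using ui by (subst card_Un_disjoint) (auto simp: card_cartesian_product)
    then show ?thesis using eq assms(2) by (simp add: mult.commute)
  qed
  then show ?thesis
    using pair_graph_strong_product[OF G pair_graph_complete]
    by (simp add: regular_graph_def out_degree_eq_card)
qed

section \<open>Excluding the topological clique minor\<close>

lemma no_topological_complete_minor_strong_product:
  assumes reg: "regular_graph G d" and tf: "triangle_free G" and "2 \<le> d"
  shows "\<not> topological_minor (complete_pair_graph (k * d + 2)) (G \<boxtimes> complete_pair_graph k)"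
proof
  assume "topological_minor (complete_pair_graph (k * d + 2)) (G \<boxtimes> complete_pair_graph k)"
  then obtain H S where
    iso: "digraph_iso (with_proj (complete_pair_graph (k * d + 2))) (with_proj H)" and
    sub: "subdivision_pair H S" and SG: "subgraph (with_proj S) (with_proj (G \<boxtimes> complete_pair_graph k))"
    unfolding topological_minor_def by blast
  have G: "pair_graph G" using reg by (simp add: regular_graph_def)
  interpret G: pair_graph G by fact
  note cardH = digraph_iso_complete_pair_graph(1)[OF iso]
  note clique = digraph_iso_complete_pair_graph(2)[OF iso]
  have SA: "parcs S \<subseteq> parcs (G \<boxtimes> complete_pair_graph k)"
    and HV: "pverts H \<subseteq> pverts G \<times> {..<k}"
    using SG subdivision_verts_subset[OF sub]
    by (auto simp: subgraph_def strong_product_def complete_pair_graph_def)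
  have adj: "u = v \<or> (u, v) \<in> parcs G" if b: "(u, i) \<in> pverts H" and c: "(v, j) \<in> pverts H" for u v i j
  proof (rule ccontr)
    assume neg: "\<not> (u = v \<or> (u, v) \<in> parcs G)"
    let ?N = "{x. (u, x) \<in> parcs G}"
    have "u \<in> pverts G" using b HV by auto
    then have "card ?N = d" using reg by (simp add: regular_graph_def out_degree_eq_card)
    moreover have "finite ?N"
      by (rule finite_subset[OF _ G.pair_finite_verts]) (use G.wellformed' in auto)
    moreover have "card (pverts H) \<le> card (?N \<times> {..<k}) + 1"
    \<comment> \<open>Arcs leaving the copies of \<open>u\<close> end in the \<open>k * d\<close>
      vertices over neighbours of \<open>u\<close>, so these separate \<open>(u, i)\<close> from
      \<open>(v, j)\<close>. The bound reads \<open>k * d + 2 \<le> k * d + 1\<close>, a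
      contradiction.\<close>
    proof (rule clique_subdivision_separator[OF sub clique,
            where F = "{u} \<times> UNIV" and b = "(u, i)" and c = "(v, j)"])
      show "y \<in> ?N \<times> {..<k}" if "(x, y) \<in> parcs S" "x \<in> {u} \<times> UNIV" "y \<notin> {u} \<times> UNIV" for x y
        using that SA by (cases y) (auto simp: parcs_strong_product_complete)
    qed (use b c neg \<open>finite ?N\<close> in auto)
    ultimately show False using cardH by (simp add: card_cartesian_product mult.commute)
  qed
  obtain u i where b: "(u, i) \<in> pverts H" using cardH by (metis card.empty add_is_0 equals0I surj_pair zero_neq_numeral)
  have "\<exists>v. pverts H \<subseteq> {u, v} \<times> {..<k}"
  proof (cases "\<exists>v j. (v, j) \<in> pverts H \<and> v \<noteq> u")
    case True
    then obtain v j where c: "(v, j) \<in> pverts H" "v \<noteq> u" by auto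
    \<comment> \<open>A third vertex \<open>w\<close> below a branch vertex would be adjacent to
      both \<open>u\<close> and \<open>v\<close> and close a triangle.\<close>
    have "w = u \<or> w = v" if "(w, l) \<in> pverts H" for w l
      using adj[OF b c(1)] adj[OF c(1) that] adj[OF b that] c(2) tf
      by (auto simp: triangle_free_def)
    then show ?thesis using HV by blast
  next
    case False
    then show ?thesis using HV by blast
  qed
  then obtain v where "pverts H \<subseteq> {u, v} \<times> {..<k}" by blast
  then have "card (pverts H) \<le> card ({u, v} \<times> {..<k})" by (rule card_mono[rotated]) simp
  also have "\<dots> \<le> 2 * k" by (simp add: card_cartesian_product card_insert_if)
  finally show False using cardH mult_le_mono2[OF \<open>2 \<le> d\<close>, of k] by simp
qed

section \<open>The spectrum of a strong product with a complete graph\<close>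

lemma char_poly_four_block_mat_lower_left_zero:
  fixes A :: "'a :: idom mat"
  assumes A: "A \<in> carrier_mat n n" and B: "B \<in> carrier_mat n m" and D: "D \<in> carrier_mat m m"
  shows "char_poly (four_block_mat A B (0\<^sub>m m n) D) = char_poly A * char_poly D"
proof -
  have "char_poly_matrix (four_block_mat A B (0\<^sub>m m n) D) =
    four_block_mat (char_poly_matrix A) (map_mat (\<lambda>a. [:- a:]) B) (0\<^sub>m m n) (char_poly_matrix D)"
    using A B D by (intro eq_matI) (auto simp: char_poly_matrix_def)
  then show ?thesis
    unfolding char_poly_def
    using det_four_block_mat_lower_left_zero[of "char_poly_matrix A" n "map_mat (\<lambda>a. [:- a:]) B" m
        "0\<^sub>m m n" "char_poly_matrix D"] A B D by simp
qed

text \<open>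
  Conjugating by the block unitriangular matrix with lower left block \<open>U\<close> makes the matrix block
  upper triangular, with \<open>- 1\<close> in the lower right corner.
\<close>

lemma char_poly_four_block_mat_clone:
  fixes M :: "'a :: idom mat"
  assumes M: "M \<in> carrier_mat n n" and U: "U \<in> carrier_mat m n" and V: "V \<in> carrier_mat n m"
    and VU: "V * U = c \<cdot>\<^sub>m 1\<^sub>m n"
  shows "char_poly (four_block_mat (M - 1\<^sub>m n) (M * V) (U * M) (U * (M * V) - 1\<^sub>m m)) =
    char_poly ((c + 1) \<cdot>\<^sub>m M - 1\<^sub>m n) * char_poly (- 1\<^sub>m m)"
proof -
  \<comment> \<open>\<open>B\<close> is W M Z - 1, where W is the block column with entries 1 and
    \<open>U\<close>, and Z the block row with entries 1 and \<open>V\<close>. Since Z W = 1 +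
    \<open>V * U\<close> is \<open>c + 1\<close> times the identity, W M Z acts on the image of W as
    \<open>(c + 1) \<cdot>\<^sub>m M\<close>; this is the upper left corner of
    \<open>C\<close>.\<close>
  define B where "B = four_block_mat (M - 1\<^sub>m n) (M * V) (U * M) (U * (M * V) - 1\<^sub>m m)"
  define C where "C = four_block_mat ((c + 1) \<cdot>\<^sub>m M - 1\<^sub>m n) (M * V) (0\<^sub>m m n) (- 1\<^sub>m m)"
  define P where "P = four_block_mat (1\<^sub>m n) (0\<^sub>m n m) U (1\<^sub>m m)"
  define Q where "Q = four_block_mat (1\<^sub>m n) (0\<^sub>m n m) (- U) (1\<^sub>m m)"
  have MV: "M * V \<in> carrier_mat n m" and UM: "U * M \<in> carrier_mat m n"
    and UMV: "U * (M * V) \<in> carrier_mat m m" using M U V by auto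
  have carr: "{B, C, P, Q} \<subseteq> carrier_mat (n + m) (n + m)"
    using M U V by (auto simp: B_def C_def P_def Q_def)
  have PQ: "P * Q = 1\<^sub>m (n + m)"
    unfolding P_def Q_def
    by (subst mult_four_block_mat) (use U in \<open>auto simp flip: four_block_one_mat simp: add_uminus_minus_mat[OF U U]\<close>)
  have QP: "Q * P = 1\<^sub>m (n + m)"
    unfolding P_def Q_def
    by (subst mult_four_block_mat) (use U in \<open>auto simp flip: four_block_one_mat\<close>)
  have MVU: "M * V * U = c \<cdot>\<^sub>m M"
    using assoc_mult_mat[OF M V U] mult_smult_distrib[OF M one_carrier_mat] M VU by simp
  have 1: "M - 1\<^sub>m n + c \<cdot>\<^sub>m M = (c + 1) \<cdot>\<^sub>m M - 1\<^sub>m n"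
    using M by (intro eq_matI) (auto simp: algebra_simps)
  have UMVU: "(U * (M * V)) * U = c \<cdot>\<^sub>m (U * M)"
    using assoc_mult_mat[OF U MV U] MVU mult_smult_distrib[OF U M] by simp
  have "B * P = four_block_mat ((c + 1) \<cdot>\<^sub>m M - 1\<^sub>m n) (M * V) ((c + 1) \<cdot>\<^sub>m (U * M) - U) (U * (M * V) - 1\<^sub>m m)"
  proof -
    have "U * M + (U * (M * V) - 1\<^sub>m m) * U = (c + 1) \<cdot>\<^sub>m (U * M) - U"
      unfolding minus_mult_distrib_mat[OF UMV one_carrier_mat U] UMVU left_mult_one_mat[OF U]
      using UM U by (intro eq_matI) (auto simp: algebra_simps)
    then show ?thesis
      unfolding B_def P_def
      by (subst mult_four_block_mat[where ?nr1.0 = n and ?n1.0 = n and ?n2.0 = m and ?nr2.0 = m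
            and ?nc1.0 = n and ?nc2.0 = m])
         (use M U V MVU 1 in \<open>auto simp: right_mult_one_mat[of _ m m]\<close>)
  qed
  moreover have "P * C = four_block_mat ((c + 1) \<cdot>\<^sub>m M - 1\<^sub>m n) (M * V) ((c + 1) \<cdot>\<^sub>m (U * M) - U) (U * (M * V) - 1\<^sub>m m)"
  proof -
    have "U * ((c + 1) \<cdot>\<^sub>m M - 1\<^sub>m n) = (c + 1) \<cdot>\<^sub>m (U * M) - U"
      using mult_minus_distrib_mat[OF U smult_carrier_mat[OF M] one_carrier_mat]
        mult_smult_distrib[OF U M] U by simp
    moreover have "U * (M * V) + - 1\<^sub>m m = U * (M * V) - 1\<^sub>m m"
      using UMV by (intro eq_matI) auto
    ultimately show ?thesis
      unfolding C_def P_def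
      by (subst mult_four_block_mat[where ?nr1.0 = n and ?n1.0 = n and ?n2.0 = m and ?nr2.0 = m
            and ?nc1.0 = n and ?nc2.0 = m])
         (use M U V MV in \<open>auto simp: right_add_zero_mat[of _ m n]\<close>)
  qed
  ultimately have "B * P = P * C" by simp
  then have "B = P * C * Q"
    using carr PQ assoc_mult_mat[of B "n + m" "n + m" P "n + m" Q "n + m"] by auto
  then have "char_poly B = char_poly C"
    using carr PQ QP by (intro char_poly_similar similar_matI) auto
  also have "\<dots> = char_poly ((c + 1) \<cdot>\<^sub>m M - 1\<^sub>m n) * char_poly (- 1\<^sub>m m)"
    unfolding C_def
    by (rule char_poly_four_block_mat_lower_left_zero[OF minus_carrier_mat[OF one_carrier_mat] MV]) simp
  finally show ?thesis unfolding B_def .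
qed

text \<open>Since x - (r A + s) = r ((x - s) / r - A), taking determinants relates the two
  characteristic polynomials by a substitution and a factor \<open>r ^ n\<close>, which is spread
  over the \<open>n\<close> linear factors. Comparing values suffices because the field is
  infinite.\<close>

lemma char_poly_affine:
  fixes A :: "'a :: field_char_0 mat"
  assumes A: "A \<in> carrier_mat n n" and split: "char_poly A = (\<Prod>a\<leftarrow>as. [:- a, 1:])"
    and "r \<noteq> 0"
  shows "char_poly (r \<cdot>\<^sub>m A + s \<cdot>\<^sub>m 1\<^sub>m n) = (\<Prod>a\<leftarrow>as. [:- (r * a + s), 1:])"
proof -
  have len: "length as = n"
    using degree_monic_char_poly[OF A] degree_linear_factors[of uminus as] split by simp
  have C: "r \<cdot>\<^sub>m A + s \<cdot>\<^sub>m 1\<^sub>m n \<in> carrier_mat n n" using A by auto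
  show ?thesis
  proof (intro poly_eq_poly_eq_iff[THEN iffD1] ext)
    fix x
    have "- char_matrix (r \<cdot>\<^sub>m A + s \<cdot>\<^sub>m 1\<^sub>m n) x = r \<cdot>\<^sub>m (- char_matrix A ((x - s) / r))"
      using A \<open>r \<noteq> 0\<close> by (intro eq_matI) (auto simp: char_matrix_def field_simps)
    then have "poly (char_poly (r \<cdot>\<^sub>m A + s \<cdot>\<^sub>m 1\<^sub>m n)) x = r ^ n * poly (char_poly A) ((x - s) / r)"
      using char_matrix_closed[OF A, of "(x - s) / r"]
      by (simp add: char_poly_matrix[OF C] char_poly_matrix[OF A] carrier_matD)
    also have "\<dots> = r ^ length as * (\<Prod>a\<leftarrow>as. (x - s) / r - a)"
      by (simp add: split len poly_prod_list o_def)
    also have "\<dots> = (\<Prod>a\<leftarrow>as. x - (r * a + s))"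
      using \<open>r \<noteq> 0\<close> by (induction as) (auto simp: field_simps)
    finally show "poly (char_poly (r \<cdot>\<^sub>m A + s \<cdot>\<^sub>m 1\<^sub>m n)) x = poly (\<Prod>a\<leftarrow>as. [:- (r * a + s), 1:]) x"
      by (simp add: poly_prod_list o_def algebra_simps)
  qed
qed

lemma char_poly_uminus_one: "char_poly (- 1\<^sub>m m :: 'a :: idom mat) = [:1, 1:] ^ m"
proof -
  have "diag_mat (- 1\<^sub>m m :: 'a mat) = replicate m (- 1)"
    by (auto simp: diag_mat_def intro!: nth_equalityI)
  then show ?thesis
    by (subst char_poly_upper_triangular[where n = m]) auto
qed

section \<open>Real symmetric matrices have real spectrum\<close>

text \<open>Over the complex numbers the polynomial splits. A Rayleigh quotient shows every root to
  be real, and injectivity of the coefficient embedding carries the factorization back to the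
  reals.\<close>

lemma char_poly_real_symmetric_splits:
  fixes A :: "real mat"
  assumes A: "A \<in> carrier_mat n n" and sym: "\<And>i j. \<lbrakk>i < n; j < n\<rbrakk> \<Longrightarrow> A $$ (i, j) = A $$ (j, i)"
  obtains as where "char_poly A = (\<Prod>a\<leftarrow>as. [:- a, 1:])" "length as = n"
proof -
  interpret hom: map_poly_inj_idom_hom complex_of_real ..
  define Ac where "Ac = map_mat complex_of_real A"
  have Ac: "Ac \<in> carrier_mat n n" using A by (simp add: Ac_def)
  obtain zs where zs: "char_poly Ac = (\<Prod>z\<leftarrow>zs. [:- z, 1:])" "length zs = n"
    using char_poly_factorized[OF Ac] by blast
  have "z \<in> \<real>" if "z \<in> set zs" for z
  proof -
    have "poly (char_poly Ac) z = 0"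
      unfolding zs(1) poly_prod_list using that by (auto simp: prod_list_zero_iff)
    then have "eigenvalue Ac z" using eigenvalue_root_char_poly[OF Ac] by blast
    then obtain v where v: "v \<in> carrier_vec n" "v \<noteq> 0\<^sub>v n" "Ac *\<^sub>v v = z \<cdot>\<^sub>v v"
      using Ac by (auto simp: eigenvalue_def eigenvector_def)
    have entry: "(\<Sum>j<n. of_real (A $$ (i, j)) * v $ j) = z * v $ i" if "i < n" for i
      using arg_cong[OF v(3), of "\<lambda>w. w $ i"] that v(1) A
      by (simp add: Ac_def scalar_prod_def lessThan_atLeast0)
    \<comment> \<open>\<open>q\<close> is v* A v and \<open>s\<close> is v* v. By symmetry of
      \<open>A\<close> the first is its own conjugate, the second is real and nonzero, and
      \<open>q = z * s\<close> then makes \<open>z\<close> real.\<close>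
    define q where "q = (\<Sum>i<n. \<Sum>j<n. of_real (A $$ (i, j)) * v $ j * cnj (v $ i))"
    define s where "s = (\<Sum>i<n. v $ i * cnj (v $ i))"
    have "q = z * s"
      unfolding q_def s_def sum_distrib_left sum_distrib_right[symmetric]
      by (rule sum.cong[OF refl]) (simp add: entry)
    moreover have "cnj q = q"
    proof -
      have "cnj q = (\<Sum>i<n. \<Sum>j<n. of_real (A $$ (i, j)) * cnj (v $ j) * v $ i)"
        by (simp add: q_def)
      also have "\<dots> = (\<Sum>j<n. \<Sum>i<n. of_real (A $$ (i, j)) * cnj (v $ j) * v $ i)"
        by (rule sum.swap)
      also have "\<dots> = q"
        unfolding q_def using sym by (intro sum.cong refl) (simp add: mult_ac)
      finally show ?thesis .
    qed
    moreover have s_eq: "s = of_real (\<Sum>i<n. (cmod (v $ i))\<^sup>2)"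
      by (simp add: s_def flip: complex_norm_square)
    moreover have "s \<noteq> 0"
    proof
      assume "s = 0"
      then have "(\<Sum>i<n. (cmod (v $ i))\<^sup>2) = 0" using s_eq of_real_eq_0_iff by metis
      then have "v $ i = 0" if "i < n" for i using that by (simp add: sum_nonneg_eq_0_iff)
      then show False using v by (auto intro!: eq_vecI)
    qed
    ultimately have "cnj z = z" by auto
    then show ?thesis using Reals_cnj_iff by blast
  qed
  then have "(\<Prod>z\<leftarrow>zs. [:- z, 1:]) = map_poly complex_of_real (\<Prod>a\<leftarrow>map Re zs. [:- a, 1:])"
    by (auto simp: hom.hom_prod_list intro!: arg_cong[of _ _ prod_list])
  moreover have "char_poly Ac = map_poly complex_of_real (char_poly A)"
    unfolding Ac_def by (rule of_real_hom.char_poly_hom[OF A])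
  ultimately have "map_poly complex_of_real (char_poly A) =
      map_poly complex_of_real (\<Prod>a\<leftarrow>map Re zs. [:- a, 1:])"
    using zs(1) by simp
  then have "char_poly A = (\<Prod>a\<leftarrow>map Re zs. [:- a, 1:])"
    by (rule hom.injectivity)
  then show ?thesis using that zs(2) by (metis length_map)
qed

section \<open>The adjacency matrix of the product as a blow-up of \<open>A + 1\<close>\<close>

lemma sum_mod_lessThan_mult:
  fixes f :: "nat \<Rightarrow> 'a :: comm_semiring_1"
  shows "(\<Sum>l<c * n. f (l mod n)) = of_nat c * (\<Sum>l<n. f l)"
proof -
  have "(\<Sum>l<c * n. f (l mod n)) = (\<Sum>j<c. \<Sum>l=j * n..<j * n + n. f (l mod n))"
    by (rule sum.nat_group[symmetric])
  also have "\<dots> = (\<Sum>j<c. \<Sum>l<n. f l)"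
  proof (rule sum.cong[OF refl])
    fix j
    have "(\<Sum>l=0 + j * n..<n + j * n. f (l mod n)) = (\<Sum>l=0..<n. f ((l + j * n) mod n))"
      by (rule sum.shift_bounds_nat_ivl)
    then show "(\<Sum>l=j * n..<j * n + n. f (l mod n)) = (\<Sum>l<n. f l)"
      by (simp add: add.commute lessThan_atLeast0)
  qed
  finally show ?thesis by simp
qed

text \<open>The listing \<open>ws\<close> runs through the product layer by layer: index
  \<open>i\<close> stands for vertex \<open>i mod n\<close> in layer \<open>i div n\<close>. Layer 0
  fills the first block and the other \<open>k - 1\<close> layers are clones of it, so the block
  formula applies with \<open>c = k - 1\<close>.\<close>

lemma char_poly_adjacency_mat_strong_product_complete:
  assumes G: "pair_graph G" and "1 \<le> k" and vs: "distinct vs" "set vs = pverts G"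
  defines "n \<equiv> length vs"
  defines "ws \<equiv> map (\<lambda>i. (vs ! (i mod n), i div n)) [0..<k * n]"
  shows "char_poly (adjacency_mat ws (G \<boxtimes> complete_pair_graph k)) =
    char_poly (real k \<cdot>\<^sub>m adjacency_mat vs G + real (k - 1) \<cdot>\<^sub>m 1\<^sub>m n) * [:1, 1:] ^ ((k - 1) * n)"
proof -
  interpret G: pair_graph G by fact
  define m where "m = (k - 1) * n"
  have nm: "n + m = k * n" using \<open>1 \<le> k\<close> by (cases k) (auto simp: m_def)
  define A where "A = adjacency_mat vs G"
  define M where "M = A + 1\<^sub>m n"
  \<comment> \<open>Multiplying by \<open>U\<close> on the left repeats the rows of a matrix once
    for each cloned layer; multiplying by \<open>V\<close> on the right does so for columns.\<close>
  define U :: "real mat" where "U = mat m n (\<lambda>(i, j). if i mod n = j then 1 else 0)"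
  define V where "V = transpose_mat U"
  have A: "A \<in> carrier_mat n n" by (simp add: A_def adjacency_mat_def n_def)
  have M: "M \<in> carrier_mat n n" using A by (simp add: M_def)
  have U: "U \<in> carrier_mat m n" and V: "V \<in> carrier_mat n m" by (simp_all add: U_def V_def)
  have mod: "i mod n < n" if "i < m" for i
    using that by (cases "n = 0") (auto simp: m_def)
  have MV: "(M * V) $$ (i, j) = M $$ (i, j mod n)" if "i < n" "j < m" for i j
  proof -
    have "(M * V) $$ (i, j) = (\<Sum>l\<in>{0..<n}. M $$ (i, l) * (if j mod n = l then 1 else 0))"
      using that M U by (auto simp: V_def U_def scalar_prod_def)
    then show ?thesis using mod[OF that(2)] by (simp add: if_distrib[where f = "(*) _"] cong: if_cong)
  qed
  have UM: "(U * X) $$ (i, j) = X $$ (i mod n, j)" if "i < m" "j < c" "X \<in> carrier_mat n c" for i j c X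
  proof -
    have "(U * X) $$ (i, j) = (\<Sum>l\<in>{0..<n}. (if i mod n = l then 1 else 0) * X $$ (l, j))"
      using that by (auto simp: U_def scalar_prod_def)
    then show ?thesis using mod[OF that(1)] by (simp add: if_distrib[where f = "\<lambda>x. x * _"] cong: if_cong)
  qed
  \<comment> \<open>Distinct columns of \<open>U\<close> have disjoint supports, and each residue
    modulo \<open>n\<close> occurs \<open>k - 1\<close> times below \<open>m\<close>.\<close>
  have VU: "V * U = real (k - 1) \<cdot>\<^sub>m 1\<^sub>m n"
  proof (rule eq_matI)
    fix i j assume "i < dim_row (real (k - 1) \<cdot>\<^sub>m 1\<^sub>m n)" "j < dim_col (real (k - 1) \<cdot>\<^sub>m 1\<^sub>m n)"
    then have ij: "i < n" "j < n" by auto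
    define g where "g r = (if r = i then if i = j then 1 else 0 else 0 :: real)" for r
    have "(V * U) $$ (i, j) = (\<Sum>l<m. g (l mod n))"
      using ij by (auto simp: V_def U_def scalar_prod_def lessThan_atLeast0 g_def intro!: sum.cong sum.neutral)
    also have "\<dots> = real (k - 1) * (\<Sum>l<n. g l)"
      unfolding m_def by (rule sum_mod_lessThan_mult)
    also have "(\<Sum>l<n. g l) = (if i = j then 1 else 0)"
      using ij by (simp add: g_def)
    finally show "(V * U) $$ (i, j) = (real (k - 1) \<cdot>\<^sub>m 1\<^sub>m n) $$ (i, j)"
      using ij by simp
  qed (use U V in auto)
  have "adjacency_mat ws (G \<boxtimes> complete_pair_graph k) =
    four_block_mat (M - 1\<^sub>m n) (M * V) (U * M) (U * (M * V) - 1\<^sub>m m)" (is "?L = ?R")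
  proof (rule eq_matI)
    fix i j assume "i < dim_row ?R" "j < dim_col ?R"
    then have ij: "i < n + m" "j < n + m" using M U V by auto
    then have "0 < n" using nm by (cases "n = 0") auto
    have lt: "i < k * n" "j < k * n" using ij nm by auto
    have less: "i mod n < n" "j mod n < n" using \<open>0 < n\<close> by auto
    then have idx: "vs ! (i mod n) = vs ! (j mod n) \<longleftrightarrow> i mod n = j mod n"
      unfolding n_def by (rule nth_eq_iff_index_eq[OF vs(1)])
    have mem: "vs ! (i mod n) \<in> pverts G"
      using less(1) nth_mem vs(2) unfolding n_def by blast
    have div: "i div n < k" "j div n < k" using lt by (auto intro: less_mult_imp_div_less)
    have eq_iff: "i = j \<longleftrightarrow> i mod n = j mod n \<and> i div n = j div n"
      by (metis div_mult_mod_eq)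
    have loop: "(vs ! (j mod n), vs ! (j mod n)) \<notin> parcs G" using G.no_loops' by blast
    have "?L $$ (i, j) = (if (vs ! (i mod n), vs ! (j mod n)) \<in> parcs G \<or>
        i mod n = j mod n \<and> i div n \<noteq> j div n then 1 else 0)"
      using lt div mem idx
      by (simp add: adjacency_mat_def ws_def parcs_strong_product_complete)
    moreover have "M $$ (i mod n, j mod n) =
        (if (vs ! (i mod n), vs ! (j mod n)) \<in> parcs G then 1 else 0) + (if i mod n = j mod n then 1 else 0)"
      using less by (simp add: M_def A_def adjacency_mat_def n_def)
    \<comment> \<open>The 1 on the diagonal of \<open>M\<close> makes copies of one vertex adjacent
      across layers; subtracting at \<open>i = j\<close> removes the loops. All four blocks follow,
      since \<open>i\<close> and \<open>i - n\<close> have the same residue.\<close>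
    ultimately have L: "?L $$ (i, j) = M $$ (i mod n, j mod n) - (if i = j then 1 else 0)"
      using eq_iff loop by (cases "i mod n = j mod n") auto
    have MVc: "M * V \<in> carrier_mat n m" using M V by simp
    show "?L $$ (i, j) = ?R $$ (i, j)"
      unfolding L using ij M U V MVc less
      by (cases "i < n"; cases "j < n")
        (auto simp: MV UM[OF _ _ M] UM[OF _ _ MVc] le_mod_geq simp del: index_mult_mat(1))
  qed (use M U V nm in \<open>auto simp: adjacency_mat_def ws_def\<close>)
  moreover have "(real (k - 1) + 1) \<cdot>\<^sub>m M - 1\<^sub>m n = real k \<cdot>\<^sub>m A + real (k - 1) \<cdot>\<^sub>m 1\<^sub>m n"
    using A \<open>1 \<le> k\<close> by (intro eq_matI) (auto simp: M_def of_nat_diff algebra_simps)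
  ultimately show ?thesis
    using char_poly_four_block_mat_clone[OF M U V VU]
    by (simp add: char_poly_uminus_one A_def m_def)
qed

section \<open>Eigenvalues with multiplicity\<close>

lemma char_poly_adjacency_mat_splits:
  assumes "pair_graph G"
  obtains as where "char_poly (adjacency_mat vs G) = (\<Prod>a\<leftarrow>as. [:- a, 1:])"
    "length as = length vs"
proof -
  interpret pair_graph G by fact
  have "adjacency_mat vs G \<in> carrier_mat (length vs) (length vs)"
    by (simp add: adjacency_mat_def)
  then show ?thesis
    by (rule char_poly_real_symmetric_splits)
       (use that in \<open>auto simp: adjacency_mat_def dest: arcs_symmetric\<close>)
qed

lemma proots_prod_linear_factors:
  "proots (\<Prod>a\<leftarrow>as. [:- f a, 1:] :: 'a :: idom poly) = mset (map f as)"
proof -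
  have "0 \<notin> set (map (\<lambda>a. [:- f a, 1:]) as)" by auto
  from proots_prod_list[OF this]
  have "proots (\<Prod>a\<leftarrow>as. [:- f a, 1:]) = (\<Sum>a\<leftarrow>as. proots [:- f a, 1:])" by (simp add: o_def)
  also have "\<dots> = mset (map f as)" by (induction as) auto
  finally show ?thesis .
qed

lemma size_graph_eigenvalues:
  assumes "pair_graph G"
  shows "size (graph_eigenvalues G) = card (pverts G)"
proof -
  interpret pair_graph G by fact
  obtain vs where vs: "distinct vs" "set vs = pverts G"
    using finite_distinct_list[OF pair_finite_verts] by blast
  obtain as where "char_poly (adjacency_mat vs G) = (\<Prod>a\<leftarrow>as. [:- a, 1:])" "length as = length vs"
    using char_poly_adjacency_mat_splits[OF assms] by blast
  then show ?thesis
    using vs distinct_card[OF vs(1)] by (simp add: graph_eigenvalues_eq[OF vs] proots_prod_linear_factors)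
qed

lemma graph_eigenvalues_strong_product_complete:
  assumes G: "pair_graph G" and "1 \<le> k"
  shows "graph_eigenvalues (G \<boxtimes> complete_pair_graph k) =
    image_mset (\<lambda>a. real k * a + real (k - 1)) (graph_eigenvalues G) +
    replicate_mset ((k - 1) * card (pverts G)) (- 1)"
proof -
  interpret pair_graph G by fact
  obtain vs where vs: "distinct vs" "set vs = pverts G"
    using finite_distinct_list[OF pair_finite_verts] by blast
  define n where "n = length vs"
  have n: "n = card (pverts G)" using distinct_card[OF vs(1)] vs(2) by (simp add: n_def)
  define ws where "ws = map (\<lambda>i. (vs ! (i mod n), i div n)) [0..<k * n]"
  have bound: "i mod n < n" "i div n < k" if "i < k * n" for i
    using that by (cases "n = 0"; auto intro: less_mult_imp_div_less)+
  have dist: "distinct ws"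
    unfolding ws_def distinct_map
  proof (intro conjI inj_onI)
    fix i j assume "i \<in> set [0..<k * n]" "j \<in> set [0..<k * n]"
      "(vs ! (i mod n), i div n) = (vs ! (j mod n), j div n)"
    then have "i mod n = j mod n" "i div n = j div n"
      using bound[of i] bound[of j] vs(1) by (auto simp: nth_eq_iff_index_eq n_def)
    then show "i = j" by (metis div_mult_mod_eq)
  qed simp
  have V: "pverts (G \<boxtimes> complete_pair_graph k) = pverts G \<times> {..<k}"
    by (simp add: strong_product_def complete_pair_graph_def)
  have "set ws \<subseteq> pverts G \<times> {..<k}"
    using bound vs(2) by (auto simp: ws_def n_def)
  moreover have "card (set ws) = card (pverts G \<times> {..<k})"
    using distinct_card[OF dist] by (simp add: ws_def n card_cartesian_product)
  \<comment> \<open>Distinctness gives \<open>ws\<close> as many entries as the product has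
    vertices, so inclusion is enough.\<close>
  ultimately have set: "set ws = pverts (G \<boxtimes> complete_pair_graph k)"
    unfolding V by (intro card_subset_eq) (auto simp: pair_finite_verts)
  obtain as where as: "char_poly (adjacency_mat vs G) = (\<Prod>a\<leftarrow>as. [:- a, 1:])"
    using char_poly_adjacency_mat_splits[OF G] by blast
  have A: "adjacency_mat vs G \<in> carrier_mat n n" by (simp add: adjacency_mat_def n_def)
  have "char_poly (adjacency_mat ws (G \<boxtimes> complete_pair_graph k)) =
      (\<Prod>a\<leftarrow>as. [:- (real k * a + real (k - 1)), 1:]) * [:1, 1:] ^ ((k - 1) * n)"
    using char_poly_adjacency_mat_strong_product_complete[OF G \<open>1 \<le> k\<close> vs]
      char_poly_affine[OF A as, of "real k" "real (k - 1)"] \<open>1 \<le> k\<close>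
    by (simp add: ws_def n_def)
  moreover have "(\<Prod>a\<leftarrow>as. [:- (real k * a + real (k - 1)), 1:]) \<noteq> 0"
    by (auto simp: prod_list_zero_iff)
  ultimately have "graph_eigenvalues (G \<boxtimes> complete_pair_graph k) =
      mset (map (\<lambda>a. real k * a + real (k - 1)) as) + repeat_mset ((k - 1) * n) {#- 1#}"
    using proots_prod_linear_factors[of "\<lambda>a. real k * a + real (k - 1)" as]
    by (simp add: graph_eigenvalues_eq[OF dist set] proots_mult proots_power)
  moreover have "graph_eigenvalues G = mset as"
    using proots_prod_linear_factors[of "\<lambda>a. a" as] as by (simp add: graph_eigenvalues_eq[OF vs])
  moreover have "repeat_mset c {#x#} = replicate_mset c x" for c and x :: real
    by (induction c) auto
  ultimately show ?thesis by (simp add: n)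
qed

text \<open>The all-ones vector is an eigenvector, because every row of the adjacency matrix sums to
  the degree. This provides a nonnegative eigenvalue, whose image in the product dominates
  \<open>- 1\<close>.\<close>

lemma degree_in_graph_eigenvalues:
  assumes reg: "regular_graph G d" and "pverts G \<noteq> {}"
  shows "real d \<in># graph_eigenvalues G"
proof -
  have G: "pair_graph G" using reg by (simp add: regular_graph_def)
  interpret pair_graph G by fact
  obtain vs where vs: "distinct vs" "set vs = pverts G"
    using finite_distinct_list[OF pair_finite_verts] by blast
  define n where "n = length vs"
  define A where "A = adjacency_mat vs G"
  have A: "A \<in> carrier_mat n n" by (simp add: A_def adjacency_mat_def n_def)
  define e :: "real vec" where "e = vec n (\<lambda>_. 1)"
  have "A *\<^sub>v e = real d \<cdot>\<^sub>v e"
  proof (rule eq_vecI)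
    fix i assume "i < dim_vec (real d \<cdot>\<^sub>v e)"
    then have i: "i < n" by (simp add: e_def)
    have "(A *\<^sub>v e) $ i = (\<Sum>j\<in>{0..<n}. if (vs ! i, vs ! j) \<in> parcs G then 1 else 0)"
      using i A by (auto simp: e_def A_def adjacency_mat_def scalar_prod_def n_def intro!: sum.cong)
    also have "\<dots> = (\<Sum>w\<in>pverts G. if (vs ! i, w) \<in> parcs G then 1 else 0)"
      using bij_betw_nth[OF vs(1), of "{0..<n}" "pverts G"] vs
      by (intro sum.reindex_bij_betw) (auto simp: n_def lessThan_atLeast0)
    also have "\<dots> = real (card {w. (vs ! i, w) \<in> parcs G})"
    proof -
      have "{w \<in> pverts G. (vs ! i, w) \<in> parcs G} = {w. (vs ! i, w) \<in> parcs G}"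
        using wellformed' by auto
      then show ?thesis by (simp add: sum.If_cases pair_finite_verts Int_def)
    qed
    also have "\<dots> = real d"
      using reg i vs by (auto simp: regular_graph_def out_degree_eq_card n_def)
    finally show "(A *\<^sub>v e) $ i = (real d \<cdot>\<^sub>v e) $ i" using i by (simp add: e_def)
  qed (use A in \<open>auto simp: e_def\<close>)
  moreover have "e \<noteq> 0\<^sub>v n"
  proof
    assume "e = 0\<^sub>v n"
    moreover have "0 < n" using assms(2) vs by (auto simp: n_def)
    ultimately show False by (metis e_def index_vec index_zero_vec(1) zero_neq_one)
  qed
  ultimately have "eigenvalue A (real d)"
    unfolding eigenvalue_def eigenvector_def using A by (intro exI[of _ e]) (simp add: e_def)
  then have "poly (char_poly A) (real d) = 0" using eigenvalue_root_char_poly[OF A] by simp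
  moreover have "char_poly A \<noteq> 0" using degree_monic_char_poly[OF A] by auto
  ultimately show ?thesis by (simp add: graph_eigenvalues_eq[OF vs] flip: A_def)
qed

text \<open>A monotone map carries the maximum to the maximum, and
  \<open>b \<le> f a \<le> f (Max_mset S)\<close> keeps the added copies below it. It identifies the
  exempt eigenvalue of the product as the image of the exempt eigenvalue of
  \<open>G\<close>.\<close>

lemma Max_mset_image_plus_replicate:
  fixes f :: "'a :: linorder \<Rightarrow> 'b :: linorder"
  assumes "mono f" and "a \<in># S" and "b \<le> f a"
  shows "Max_mset (image_mset f S + replicate_mset c b) = f (Max_mset S)"
proof (rule Max_eqI)
  have "a \<le> Max_mset S" using assms(2) by simp
  then have "b \<le> f (Max_mset S)" using assms(3) monoD[OF assms(1)] order_trans by blast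
  then show "y \<le> f (Max_mset S)" if "y \<in># image_mset f S + replicate_mset c b" for y
    using that monoD[OF assms(1)] by (auto split: if_splits)
  have "Max_mset S \<in># S" using assms(2) by (intro Max_in) auto
  then show "f (Max_mset S) \<in># image_mset f S + replicate_mset c b" by simp
qed simp

text \<open>As the exempt eigenvalues correspond, what remains are the images of the other
  eigenvalues of \<open>G\<close>, bounded by the triangle inequality, and the copies of
  \<open>- 1\<close>.\<close>

lemma ndl_graph_strong_product_complete:
  assumes ndl: "ndl_graph n d lam G" and "2 \<le> n" and "1 \<le> k"
  shows "ndl_graph (k * n) (k * d + k - 1) (real k * lam + real k - 1) (G \<boxtimes> complete_pair_graph k)"
proof -
  have reg: "regular_graph G d" and n: "card (pverts G) = n"
    and lam: "\<And>a. a \<in># graph_eigenvalues G - {#Max_mset (graph_eigenvalues G)#} \<Longrightarrow> \<bar>a\<bar> \<le> lam"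
    using ndl by (auto simp: ndl_graph_def)
  have G: "pair_graph G" using reg by (simp add: regular_graph_def)
  define S where "S = graph_eigenvalues G"
  define f where "f a = real k * a + real (k - 1)" for a
  define T where "T = replicate_mset ((k - 1) * n) (- 1 :: real)"
  have d: "real d \<in># S"
    unfolding S_def using reg n \<open>2 \<le> n\<close> by (intro degree_in_graph_eigenvalues) auto
  have ev: "graph_eigenvalues (G \<boxtimes> complete_pair_graph k) = image_mset f S + T"
    using graph_eigenvalues_strong_product_complete[OF G \<open>1 \<le> k\<close>]
    unfolding S_def T_def f_def[abs_def] n .
  have "mono f" by (rule monoI) (simp add: f_def mult_left_mono)
  moreover have "- 1 \<le> f (real d)" unfolding f_def by (rule order_trans[of _ 0]) auto
  ultimately have Max: "Max_mset (image_mset f S + T) = f (Max_mset S)"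
    unfolding T_def by (rule Max_mset_image_plus_replicate[OF _ d])
  have MS: "Max_mset S \<in># S" using d by (intro Max_in) auto
  have "image_mset f S + T - {#f (Max_mset S)#} = image_mset f (S - {#Max_mset S#}) + T"
    using MS by (simp add: image_mset_Diff)
  then have rest: "graph_eigenvalues (G \<boxtimes> complete_pair_graph k) -
      {#Max_mset (graph_eigenvalues (G \<boxtimes> complete_pair_graph k))#} =
      image_mset f (S - {#Max_mset S#}) + T"
    using ev Max by simp
  \<comment> \<open>With \<open>2 \<le> n\<close> some eigenvalue is left after removing the
    largest, and its absolute value bounds \<open>lam\<close> from below by 0.\<close>
  have "size (S - {#Max_mset S#}) \<noteq> 0"
    using size_graph_eigenvalues[OF G] MS n \<open>2 \<le> n\<close> by (simp add: S_def size_Diff_singleton)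
  then obtain a where "a \<in># S - {#Max_mset S#}" by (metis multiset_nonemptyE size_empty)
  then have "0 \<le> lam" using lam[of a] by (simp add: S_def)
  have "\<bar>\<mu>\<bar> \<le> real k * lam + real k - 1" if "\<mu> \<in># image_mset f (S - {#Max_mset S#}) + T" for \<mu>
  proof (cases "\<mu> \<in># T")
    case True
    \<comment> \<open>For \<open>k = 1\<close> there are no copies of \<open>- 1\<close>; for
      \<open>2 \<le> k\<close> the bound is at least \<open>k - 1 \<ge> 1\<close>.\<close>
    then have "\<mu> = - 1" "2 \<le> k" using \<open>1 \<le> k\<close> by (auto simp: T_def split: if_splits)
    moreover have "0 \<le> real k * lam" using \<open>0 \<le> lam\<close> by simp
    ultimately show ?thesis by simp
  next
    case False
    then have "\<mu> \<in># image_mset f (S - {#Max_mset S#})" using that by (simp only: union_iff) blast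
    then obtain a where a: "a \<in># S - {#Max_mset S#}" "\<mu> = f a" unfolding in_image_mset by blast
    have "\<bar>\<mu>\<bar> \<le> real k * \<bar>a\<bar> + real (k - 1)"
      unfolding a(2) f_def using abs_triangle_ineq[of "real k * a" "real (k - 1)"] by (simp add: abs_mult)
    also have "\<dots> \<le> real k * lam + real (k - 1)"
      using lam[of a] a(1) by (simp add: S_def mult_left_mono)
    finally show ?thesis using \<open>1 \<le> k\<close> by (simp add: of_nat_diff)
  qed
  moreover have "card (pverts (G \<boxtimes> complete_pair_graph k)) = k * n"
    by (simp add: strong_product_def complete_pair_graph_def card_cartesian_product n)
  ultimately show ?thesis
    using regular_graph_strong_product_complete[OF reg \<open>1 \<le> k\<close>]
    unfolding ndl_graph_def rest by blast
qed

theorem theorem3p10: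
  fixes G :: "'a pair_pre_digraph" and n d k :: nat and lam :: real
  assumes "ndl_graph n d lam G"
    and "triangle_free G"
    and "7 \<le> d" and "d \<le> n - 1"
    and "2 \<le> k"
  shows "ndl_graph (k * n) (k * d + k - 1) (real k * lam + real k - 1)
           (G \<boxtimes> complete_pair_graph k)
       \<and> \<not> topological_minor (complete_pair_graph (k * d + 2)) (G \<boxtimes> complete_pair_graph k)"
proof
  show "ndl_graph (k * n) (k * d + k - 1) (real k * lam + real k - 1) (G \<boxtimes> complete_pair_graph k)"
    using assms by (intro ndl_graph_strong_product_complete) auto
  show "\<not> topological_minor (complete_pair_graph (k * d + 2)) (G \<boxtimes> complete_pair_graph k)"
    using assms by (intro no_topological_complete_minor_strong_product) (auto simp: ndl_graph_def)
qed

end
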